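(* Assume that $N>1$ and that there exists $\boldsymbol\theta^0=(\theta^0_1,\dots,\theta^0_N)\in\mathbb{R}^{K\times N}$ such that ${\rm Err}^G(\boldsymbol\theta^0)=0$ (so $F_{\boldsymbol\theta^0}(x)=G(x)$ for all $x\in\Omega$) and $G(x)$ is the strict minimiser of $i\mapsto h_{\theta_i^0}(x)$ over $[N]$ for all $x\in\Omega$. Then, for any fixed $\varepsilon>0$, \[ \sup_{\boldsymbol\theta\in\mathbb{R}^{K\times N}}\Phi_\varepsilon^G(\boldsymbol\theta)=0, \] and the supremum is not attained (i.e. there is no maximiser in $\mathbb{R}^{K\times N}$, even after gauge fixing, e.g. after imposing $\theta_N=0$).
   Context: Let $\overline\Omega=[-1,1]^2$ and let $\Omega\subset\overline\Omega$ be a nonempty finite set (of pixels). Let $N,K\ge 1$ be integers and $[N]:=\{1,\dots,N\}$. Let $G:\Omega\to[N]$ be a given map (the grain map) and $\eta:\overline\Omega\to\mathbb{R}^K$ a given function (the design function). For $\boldsymbol\theta=(\theta_1,\dots,\theta_N)\in\mathbb{R}^{K\times N}$ with $\theta_i\in\mathbb{R}^K$, set $h_{\theta_i}(x):=\theta_i\cdot\eta(x)$ for $x\in\overline\Omega$. Hard assignment: $F_{\boldsymbol\theta}(x):=\operatorname{arg\,min}_{i\in[N]}h_{\theta_i}(x)$, where if the minimiser is not unique the smallest minimising index is selected. Fraction of misassigned pixels: \[ {\rm Err}^G(\boldsymbol\theta):=\frac{1}{|\Omega|}\Big|\{x\in\Omega:\ F_{\boldsymbol\theta}(x)\neq G(x)\}\Big|.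 \] Soft assignment, for $\varepsilon>0$: \[ (p_{\boldsymbol\theta}^\varepsilon)_i(x):=\frac{\exp\left(-\frac1\varepsilon h_{\theta_i}(x)\right)}{\sum_{j=1}^N\exp\left(-\frac1\varepsilon h_{\theta_j}(x)\right)},\qquad i\in[N]. \] Objective function, for $\varepsilon>0$: \[ \Phi_\varepsilon^G(\boldsymbol\theta):=\frac{1}{|\Omega|}\sum_{x\in\Omega}\log\big((p_{\boldsymbol\theta}^\varepsilon)_{G(x)}(x)\big). \] Gauge fixing: $\Phi_\varepsilon^G$ is unchanged when the same $c\in\mathbb{R}^K$ is added to every $\theta_i$; gauge fixing means imposing $K$ independent linear constraints removing this common-shift direction, the simplest being $\theta_N=0$. *)

theory Defs
  imports "HOL-Analysis.Analysis"
begin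

text \<open>
  The index set \<open>[N]\<close> is a type \<open>'n\<close> of class \<open>{finite, linorder}\<close>, so \<open>N = CARD('n)\<close>; the
  order breaks ties in the hard assignment, and the last index is \<open>Max UNIV\<close>. Likewise
  \<open>K = CARD('k)\<close>, and \<open>\<theta> :: real ^ 'k ^ 'n\<close> has components \<open>\<theta> $ i :: real ^ 'k\<close>.
  The grain map and the design function are total functions on the plane, but are only ever
  evaluated at pixels.
\<close>

definition domain_closure :: "(real \<times> real) set" where
  "domain_closure = {-1..1} \<times> {-1..1}"

definition h :: "(real \<times> real \<Rightarrow> real ^ 'k) \<Rightarrow> real ^ 'k \<Rightarrow> real \<times> real \<Rightarrow> real" where
  "h \<eta> t x = t \<bullet> \<eta> x"

definition hard_assignment ::
  "(real \<times> real \<Rightarrow> real ^ 'k) \<Rightarrow> real ^ 'k ^ ('n::{finite, linorder}) \<Rightarrow> real \<times> real \<Rightarrow> 'n" where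
  "hard_assignment \<eta> \<theta> x = (LEAST i. is_arg_min (\<lambda>j. h \<eta> (\<theta> $ j) x) (\<lambda>_. True) i)"

definition Err ::
  "(real \<times> real) set \<Rightarrow> (real \<times> real \<Rightarrow> real ^ 'k) \<Rightarrow> (real \<times> real \<Rightarrow> 'n)
    \<Rightarrow> real ^ 'k ^ ('n::{finite, linorder}) \<Rightarrow> real" where
  "Err \<Omega> \<eta> G \<theta> = real (card {x \<in> \<Omega>. hard_assignment \<eta> \<theta> x \<noteq> G x}) / real (card \<Omega>)"

definition soft_assignment ::
  "(real \<times> real \<Rightarrow> real ^ 'k) \<Rightarrow> real \<Rightarrow> real ^ 'k ^ 'n \<Rightarrow> 'n \<Rightarrow> real \<times> real \<Rightarrow> real" where
  "soft_assignment \<eta> \<epsilon> \<theta> i x =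
     exp (- (1 / \<epsilon>) * h \<eta> (\<theta> $ i) x) / (\<Sum>j\<in>UNIV. exp (- (1 / \<epsilon>) * h \<eta> (\<theta> $ j) x))"

definition \<Phi> ::
  "(real \<times> real) set \<Rightarrow> (real \<times> real \<Rightarrow> real ^ 'k) \<Rightarrow> (real \<times> real \<Rightarrow> 'n)
    \<Rightarrow> real \<Rightarrow> real ^ 'k ^ 'n \<Rightarrow> real" where
  "\<Phi> \<Omega> \<eta> G \<epsilon> \<theta> = 1 / real (card \<Omega>) * (\<Sum>x\<in>\<Omega>. ln (soft_assignment \<eta> \<epsilon> \<theta> (G x) x))"

text \<open>
  The constraints are \<open>L \<theta> = b\<close>, one scalar equation for each of the \<open>K\<close> coordinates of \<open>L\<close>.
  Surjectivity is the linear independence of these equations; the last conjunct says that they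
  exclude every nonzero common shift.
\<close>

definition gauge_fixing :: "(real ^ 'k ^ 'n \<Rightarrow> real ^ 'k) \<Rightarrow> bool" where
  "gauge_fixing L \<longleftrightarrow> linear L \<and> surj L \<and> (\<forall>c. L (\<chi> i. c) = 0 \<longrightarrow> c = 0)"

end

theory Submission
  imports Defs
begin

text \<open>
  A soft assignment divides one of the \<open>N > 1\<close> positive terms by the sum of them all, hence lies
  strictly between \<open>0\<close> and \<open>1\<close>; so the objective, an average of logarithms of soft assignments,
  is strictly negative everywhere (\<open>\<Phi>_neg\<close>).  On the other hand \<open>0\<close> is approached along the ray
  \<open>t *\<^sub>R \<theta>0\<close>: with \<open>\<theta>0\<close> separating the grains strictly, scaling by \<open>t\<close> widens all gaps between
  the \<open>h\<close>-values linearly in \<open>t\<close>, which is the same as lowering the temperature \<open>\<epsilon>\<close>, and the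
  soft assignment converges to the hard one (\<open>\<Phi>_scaleR_tendsto_0\<close>).  Hence the supremum is \<open>0\<close>
  and is not attained.

  A gauge constraint does not help.  The map sending \<open>c\<close> to the value of the constraint on the
  common shift by \<open>c\<close> is an injective linear endomorphism of \<open>\<real>\<^sup>K\<close>, hence surjective, so every
  parameter can be shifted into the constraint set (\<open>gauge_fixing_shift\<close>) without changing the
  objective (\<open>\<Phi>_shift\<close>).  The constrained problem therefore has the same range of objective
  values, and a maximiser of it would be one of the unconstrained problem.
\<close>

text \<open>
  Dividing through by the numerator exhibits the dependence on differences of \<open>h\<close>-values only,
  from which the bounds, the shift invariance and the limit are all read off.
\<close>

lemma soft_assignment_eq_inverse:
  "soft_assignment \<eta> \<epsilon> \<theta> i x =
    inverse (\<Sum>j\<in>UNIV. exp ((h \<eta> (\<theta> $ i) x - h \<eta> (\<theta> $ j) x) / \<epsilon>))"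
proof -
  have "(\<Sum>j\<in>UNIV. exp ((h \<eta> (\<theta> $ i) x - h \<eta> (\<theta> $ j) x) / \<epsilon>))
      = (\<Sum>j\<in>UNIV. exp (- (1 / \<epsilon>) * h \<eta> (\<theta> $ j) x)) / exp (- (1 / \<epsilon>) * h \<eta> (\<theta> $ i) x)"
    unfolding sum_divide_distrib exp_diff[symmetric]
    by (intro sum.cong refl arg_cong[where f = exp]) (simp add: diff_divide_distrib)
  then show ?thesis
    by (simp add: soft_assignment_def)
qed

lemma soft_assignment_pos: "soft_assignment \<eta> \<epsilon> \<theta> i x > 0"
  unfolding soft_assignment_eq_inverse by (simp add: sum_pos)

lemma soft_assignment_less_1:
  fixes \<theta> :: "real ^ 'k ^ 'n"
  assumes "CARD('n) > 1"
  shows "soft_assignment \<eta> \<epsilon> \<theta> i x < 1"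
proof -
  let ?e = "\<lambda>j. exp ((h \<eta> (\<theta> $ i) x - h \<eta> (\<theta> $ j) x) / \<epsilon>)"
  have "UNIV - {i} \<noteq> {}"
  proof
    assume "UNIV - {i} = {}"
    then have "(UNIV :: 'n set) = {i}" by blast
    then have "CARD('n) = card {i}" by (rule arg_cong)
    with assms show False by simp
  qed
  then have "0 < sum ?e (UNIV - {i})"
    by (intro sum_pos) auto
  then have "1 < sum ?e UNIV"
    by (simp add: sum.remove[of UNIV i])
  then show ?thesis
    by (simp add: soft_assignment_eq_inverse inverse_less_1_iff)
qed

lemma soft_assignment_shift:
  "soft_assignment \<eta> \<epsilon> (\<theta> + (\<chi> j. c)) i x = soft_assignment \<eta> \<epsilon> \<theta> i x"
  by (simp add: soft_assignment_eq_inverse h_def inner_add_left)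

text \<open>
  Along the ray, the competing terms decay exponentially and only the term of the strict
  minimiser, constantly \<open>1\<close>, survives in the denominator.
\<close>

lemma soft_assignment_scaleR_tendsto_1:
  fixes \<theta> :: "real ^ 'k ^ 'n"
  assumes min: "\<And>j. j \<noteq> i \<Longrightarrow> h \<eta> (\<theta> $ i) x < h \<eta> (\<theta> $ j) x"
    and "\<epsilon> > 0"
  shows "((\<lambda>t. soft_assignment \<eta> \<epsilon> (t *\<^sub>R \<theta>) i x) \<longlongrightarrow> 1) at_top"
proof -
  let ?d = "\<lambda>j. (h \<eta> (\<theta> $ i) x - h \<eta> (\<theta> $ j) x) / \<epsilon>"
  have term_lim: "((\<lambda>t. exp (t * ?d j)) \<longlongrightarrow> (if j = i then 1 else 0)) at_top" for j
  proof (cases "j = i")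
    case False
    then have "?d j < 0"
      using min \<open>\<epsilon> > 0\<close> by (simp add: divide_neg_pos)
    then have "filterlim (\<lambda>t. ?d j * t) at_bot at_top"
      by (rule filterlim_tendsto_neg_mult_at_bot[OF tendsto_const _ filterlim_ident])
    then have "filterlim (\<lambda>t. t * ?d j) at_bot at_top"
      by (subst mult.commute)
    then show ?thesis
      using False by (simp add: filterlim_compose[OF exp_at_bot])
  qed simp
  have "((\<lambda>t. inverse (\<Sum>j\<in>UNIV. exp (t * ?d j))) \<longlongrightarrow>
      inverse (\<Sum>j\<in>UNIV. if j = i then 1 else 0)) at_top"
    by (intro tendsto_inverse tendsto_sum term_lim) simp
  moreover have "soft_assignment \<eta> \<epsilon> (t *\<^sub>R \<theta>) i x = inverse (\<Sum>j\<in>UNIV. exp (t * ?d j))" for t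
    by (simp add: soft_assignment_eq_inverse h_def right_diff_distrib)
  ultimately show ?thesis
    by simp
qed

lemma \<Phi>_neg:
  fixes \<theta> :: "real ^ 'k ^ 'n"
  assumes "finite \<Omega>" "\<Omega> \<noteq> {}" "CARD('n) > 1"
  shows "\<Phi> \<Omega> \<eta> G \<epsilon> \<theta> < 0"
proof -
  have "(\<Sum>x\<in>\<Omega>. ln (soft_assignment \<eta> \<epsilon> \<theta> (G x) x)) < (\<Sum>x\<in>\<Omega>. 0)"
    using assms
    by (intro sum_strict_mono) (auto simp: soft_assignment_pos soft_assignment_less_1)
  then show ?thesis
    using assms by (simp add: \<Phi>_def divide_neg_pos card_gt_0_iff)
qed

lemma \<Phi>_shift: "\<Phi> \<Omega> \<eta> G \<epsilon> (\<theta> + (\<chi> j. c)) = \<Phi> \<Omega> \<eta> G \<epsilon> \<theta>"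
  by (simp add: \<Phi>_def soft_assignment_shift)

lemma \<Phi>_scaleR_tendsto_0:
  fixes \<theta> :: "real ^ 'k ^ 'n"
  assumes "\<forall>x\<in>\<Omega>. \<forall>i. i \<noteq> G x \<longrightarrow> h \<eta> (\<theta> $ G x) x < h \<eta> (\<theta> $ i) x"
    and "\<epsilon> > 0"
  shows "((\<lambda>t. \<Phi> \<Omega> \<eta> G \<epsilon> (t *\<^sub>R \<theta>)) \<longlongrightarrow> 0) at_top"
proof -
  have "((\<lambda>t. ln (soft_assignment \<eta> \<epsilon> (t *\<^sub>R \<theta>) (G x) x)) \<longlongrightarrow> ln 1) at_top" if "x \<in> \<Omega>" for x
    using assms that by (intro tendsto_ln soft_assignment_scaleR_tendsto_1) auto
  then have "((\<lambda>t. 1 / real (card \<Omega>) * (\<Sum>x\<in>\<Omega>. ln (soft_assignment \<eta> \<epsilon> (t *\<^sub>R \<theta>) (G x) x)))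
      \<longlongrightarrow> 1 / real (card \<Omega>) * (\<Sum>x\<in>\<Omega>. ln 1)) at_top"
    by (intro tendsto_mult tendsto_const tendsto_sum)
  then show ?thesis
    by (simp add: \<Phi>_def)
qed

lemma gauge_fixing_shift:
  fixes L :: "real ^ 'k ^ 'n \<Rightarrow> real ^ 'k"
  assumes "gauge_fixing L"
  obtains c where "L (\<theta> + (\<chi> j. c)) = b"
proof -
  have L: "linear L" and triv: "\<And>c. L (\<chi> j. c) = 0 \<Longrightarrow> c = 0"
    using assms by (auto simp: gauge_fixing_def)
  define M where "M = (\<lambda>c. L (\<chi> j. c))"
  have "linear (\<lambda>c. (\<chi> j. c) :: real ^ 'k ^ 'n)"
    by (intro linearI) (simp_all add: vec_eq_iff)
  then have M: "linear M"
    using linear_compose[OF _ L] by (simp add: M_def o_def)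
  then have "inj M"
    using triv by (simp add: linear_injective_0 M_def)
  then have "surj M"
    using M linear_inj_imp_surj by blast
  then obtain c where "M c = b - L \<theta>"
    by (metis surjD)
  then have "L (\<theta> + (\<chi> j. c)) = b"
    by (simp add: M_def linear_add[OF L])
  then show thesis
    by (rule that)
qed

lemma gauge_fixing_component:
  "gauge_fixing (\<lambda>\<theta> :: real ^ 'k ^ 'n. \<theta> $ i)"
proof -
  have "linear (\<lambda>\<theta> :: real ^ 'k ^ 'n. \<theta> $ i)"
    by (intro linearI) simp_all
  moreover have "surj (\<lambda>\<theta> :: real ^ 'k ^ 'n. \<theta> $ i)"
    by (rule surjI[where f = "\<lambda>c. \<chi> j. c"]) simp
  ultimately show ?thesis
    by (simp add: gauge_fixing_def)
qed

theorem proposition4p8: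
  fixes \<Omega> :: "(real \<times> real) set"
    and \<eta> :: "real \<times> real \<Rightarrow> real ^ 'k"
    and G :: "real \<times> real \<Rightarrow> 'n::{finite, linorder}"
    and \<theta>0 :: "real ^ 'k ^ ('n::{finite, linorder})"
    and \<epsilon> :: real
  assumes "\<Omega> \<subseteq> domain_closure" and "finite \<Omega>" and "\<Omega> \<noteq> {}"
    and "CARD('n) > 1"
    and "Err \<Omega> \<eta> G \<theta>0 = 0"
    and "\<forall>x\<in>\<Omega>. \<forall>i. i \<noteq> G x \<longrightarrow> h \<eta> (\<theta>0 $ G x) x < h \<eta> (\<theta>0 $ i) x"
    and "\<epsilon> > 0"
  shows "bdd_above (range (\<Phi> \<Omega> \<eta> G \<epsilon>))
    \<and> (SUP \<theta>. \<Phi> \<Omega> \<eta> G \<epsilon> \<theta>) = 0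
    \<and> (\<nexists>\<theta>. \<Phi> \<Omega> \<eta> G \<epsilon> \<theta> = (SUP \<theta>'. \<Phi> \<Omega> \<eta> G \<epsilon> \<theta>'))
    \<and> (\<nexists>\<theta>. is_arg_max (\<Phi> \<Omega> \<eta> G \<epsilon>) (\<lambda>_. True) \<theta>)
    \<and> (\<forall>L b. gauge_fixing L \<longrightarrow> (\<nexists>\<theta>. is_arg_max (\<Phi> \<Omega> \<eta> G \<epsilon>) (\<lambda>\<theta>. L \<theta> = b) \<theta>))
    \<and> (\<nexists>\<theta>. is_arg_max (\<Phi> \<Omega> \<eta> G \<epsilon>) (\<lambda>\<theta>. \<theta> $ Max UNIV = 0) \<theta>)"
proof -
  let ?\<Phi> = "\<Phi> \<Omega> \<eta> G \<epsilon>"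
  have neg: "?\<Phi> \<theta> < 0" for \<theta>
    using assms by (intro \<Phi>_neg)
  have approach: "\<exists>\<theta>. a < ?\<Phi> \<theta>" if "a < 0" for a
  proof -
    have "\<forall>\<^sub>F t in at_top. a < ?\<Phi> (t *\<^sub>R \<theta>0)"
      using order_tendstoD(1)[OF \<Phi>_scaleR_tendsto_0 \<open>a < 0\<close>] assms by blast
    then show ?thesis
      using eventually_happens trivial_limit_at_top_linorder by blast
  qed
  have bdd: "bdd_above (range ?\<Phi>)"
    by (rule bdd_aboveI2[where M = 0]) (simp add: neg less_imp_le)
  have sup: "(SUP \<theta>. ?\<Phi> \<theta>) = 0"
  proof (rule cSup_eq_non_empty)
    show "0 \<le> y" if "\<And>v. v \<in> range ?\<Phi> \<Longrightarrow> v \<le> y" for y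
      using approach[of y] that by (meson leD not_le rangeI)
  qed (auto simp: neg less_imp_le)
  have not_attained: "\<nexists>\<theta>. ?\<Phi> \<theta> = (SUP \<theta>'. ?\<Phi> \<theta>')"
    by (metis sup neg less_irrefl)
  have no_max: "\<nexists>\<theta>. is_arg_max ?\<Phi> (\<lambda>_. True) \<theta>"
    using approach neg by (auto simp: is_arg_max_def)
  have no_gauged_max: "\<nexists>\<theta>. is_arg_max ?\<Phi> (\<lambda>\<theta>. L \<theta> = b) \<theta>" if gauge: "gauge_fixing L" for L b
  proof
    assume "\<exists>\<theta>. is_arg_max ?\<Phi> (\<lambda>\<theta>. L \<theta> = b) \<theta>"
    then obtain \<theta> where max: "is_arg_max ?\<Phi> (\<lambda>\<theta>. L \<theta> = b) \<theta>" by blast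
    obtain \<theta>' where "?\<Phi> \<theta> < ?\<Phi> \<theta>'"
      using approach neg by blast
    moreover obtain c where "L (\<theta>' + (\<chi> j. c)) = b"
      using gauge_fixing_shift[OF gauge] by blast
    ultimately show False
      using max by (auto simp: is_arg_max_def \<Phi>_shift dest: spec[of _ "\<theta>' + (\<chi> j. c)"])
  qed
  show ?thesis
    by (intro conjI allI impI bdd sup not_attained no_max
        no_gauged_max[OF gauge_fixing_component] no_gauged_max)
qed

end
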